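(* Let $\mathscr{R}$ be a ring of subsets of a non-empty set $T$, and let $\mu$ and $\nu$ be charges on $\mathscr{R}$. Then there is a decomposition $$\nu=\nu_{\ll,\mu}+\nu_{\perp,\mu}$$ into charges $\nu_{\ll,\mu},\nu_{\perp,\mu}$ on $\mathscr{R}$, where $\nu_{\ll,\mu}\ll\mu$ and $\nu_{\perp,\mu}\perp\mu$. Furthermore, if $\vartheta$ is a charge on $\mathscr{R}$ such that $\vartheta\leq\nu$ and $\vartheta\ll\mu$, then $\vartheta\leq\nu_{\ll,\mu}$.
   Context: A charge on a ring of sets $\mathscr{R}$ is a finitely additive nonnegative (real-valued) set function on $\mathscr{R}$; it is not assumed to be bounded. $\vartheta\leq\nu$ means $\vartheta(R)\leq\nu(R)$ for all $R\in\mathscr{R}$; $\vartheta$ is dominated by $\nu$ if $\vartheta\leq c\,\nu$ for some constant $c$. $\nu\ll\mu$ ($\nu$ is absolutely continuous with respect to $\mu$) means that $\mu(R)=0$ implies $\nu(R)=0$ for all $R\in\mathscr{R}$. $\nu\perp\mu$ ($\nu$ and $\mu$ are singular) means that the only charge dominated by both $\nu$ and $\mu$ is the zero charge. *)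

theory Defs
  imports "HOL-Analysis.Measure_Space"
begin

text \<open>
  Set functions are total functions \<open>'a set \<Rightarrow> real\<close>; only their values on members of the
  ring matter, so equality and order of charges are always relativised to the ring.
\<close>

definition charge :: "'a set set \<Rightarrow> ('a set \<Rightarrow> real) \<Rightarrow> bool" where
  "charge \<R> \<mu> \<longleftrightarrow> Measure_Space.additive \<R> \<mu> \<and> (\<forall>R\<in>\<R>. 0 \<le> \<mu> R)"

definition charge_le :: "'a set set \<Rightarrow> ('a set \<Rightarrow> real) \<Rightarrow> ('a set \<Rightarrow> real) \<Rightarrow> bool" where
  "charge_le \<R> \<theta> \<nu> \<longleftrightarrow> (\<forall>R\<in>\<R>. \<theta> R \<le> \<nu> R)"

definition charge_dominated :: "'a set set \<Rightarrow> ('a set \<Rightarrow> real) \<Rightarrow> ('a set \<Rightarrow> real) \<Rightarrow> bool" where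
  "charge_dominated \<R> \<theta> \<nu> \<longleftrightarrow> (\<exists>c::real. charge_le \<R> \<theta> (\<lambda>R. c * \<nu> R))"

definition charge_abs_cont :: "'a set set \<Rightarrow> ('a set \<Rightarrow> real) \<Rightarrow> ('a set \<Rightarrow> real) \<Rightarrow> bool" where
  "charge_abs_cont \<R> \<nu> \<mu> \<longleftrightarrow> (\<forall>R\<in>\<R>. \<mu> R = 0 \<longrightarrow> \<nu> R = 0)"

definition charge_singular :: "'a set set \<Rightarrow> ('a set \<Rightarrow> real) \<Rightarrow> ('a set \<Rightarrow> real) \<Rightarrow> bool" where
  "charge_singular \<R> \<nu> \<mu> \<longleftrightarrow>
     (\<forall>\<theta>. charge \<R> \<theta> \<and> charge_dominated \<R> \<theta> \<nu> \<and> charge_dominated \<R> \<theta> \<mu> \<longrightarrow>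
        (\<forall>R\<in>\<R>. \<theta> R = 0))"

end

theory Submission
  imports Defs
begin

text \<open>
  The singular part is concentrated on \<open>\<mu>\<close>-null sets: it is
  \<open>\<nu>\<^sub>s A = sup {\<nu> N | N \<subseteq> A, \<mu> N = 0}\<close>, and the absolutely continuous part is \<open>\<nu> - \<nu>\<^sub>s\<close>.
  If \<open>N \<subseteq> A\<close> is \<open>\<mu>\<close>-null, then a charge \<open>\<theta> \<lless> \<mu>\<close> satisfies \<open>\<theta> A = \<theta> (A - N)\<close>. Hence
  \<open>\<theta> \<le> \<nu>\<close> gives \<open>\<theta> A \<le> \<nu> A - \<nu> N\<close>, which yields maximality, and \<open>\<theta> \<le> c \<nu>\<^sub>s\<close> gives
  \<open>\<theta> A \<le> c (\<nu>\<^sub>s A - \<nu> N)\<close>, which is arbitrarily small and so yields singularity.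
\<close>

definition null_part :: "'a set set \<Rightarrow> ('a set \<Rightarrow> real) \<Rightarrow> ('a set \<Rightarrow> real) \<Rightarrow> 'a set \<Rightarrow> real" where
  "null_part \<R> \<mu> \<nu> A = (SUP N\<in>{N\<in>\<R>. N \<subseteq> A \<and> \<mu> N = 0}. \<nu> N)"

lemma charge_nonneg: "charge \<R> \<mu> \<Longrightarrow> A \<in> \<R> \<Longrightarrow> 0 \<le> \<mu> A"
  by (simp add: charge_def)

lemma charge_Un:
  "charge \<R> \<mu> \<Longrightarrow> A \<in> \<R> \<Longrightarrow> B \<in> \<R> \<Longrightarrow> A \<inter> B = {} \<Longrightarrow> \<mu> (A \<union> B) = \<mu> A + \<mu> B"
  by (simp add: charge_def additive_def)

text \<open>Singularity only supplies domination by \<open>\<mu>\<close>; this turns it into the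
  vanishing on null sets that the later arguments use.\<close>

lemma charge_dominated_abs_cont:
  assumes "charge \<R> \<theta>" "charge_dominated \<R> \<theta> \<mu>"
  shows "charge_abs_cont \<R> \<theta> \<mu>"
  unfolding charge_abs_cont_def
proof (intro ballI impI)
  fix A assume "A \<in> \<R>" "\<mu> A = 0"
  then have "\<theta> A \<le> 0"
    using assms(2) by (auto simp: charge_dominated_def charge_le_def)
  with charge_nonneg[OF assms(1) \<open>A \<in> \<R>\<close>] show "\<theta> A = 0" by simp
qed

context ring_of_sets
begin

lemma charge_empty: "charge M \<mu> \<Longrightarrow> \<mu> {} = 0"
  using charge_Un[of M \<mu> "{}" "{}"] by simp

lemma charge_Diff:
  assumes "charge M \<mu>" "A \<in> M" "B \<in> M" "B \<subseteq> A"
  shows "\<mu> (A - B) = \<mu> A - \<mu> B"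
proof -
  have "\<mu> (B \<union> (A - B)) = \<mu> B + \<mu> (A - B)"
    using assms(2,3) by (intro charge_Un[OF assms(1)]) auto
  moreover have "B \<union> (A - B) = A" using assms(4) by auto
  ultimately show ?thesis by simp
qed

lemma charge_mono:
  assumes "charge M \<mu>" "A \<in> M" "B \<in> M" "B \<subseteq> A"
  shows "\<mu> B \<le> \<mu> A"
  using charge_Diff[OF assms] charge_nonneg[OF assms(1), of "A - B"] assms(2,3) by auto

lemma charge_null_subset:
  assumes "charge M \<mu>" "A \<in> M" "B \<in> M" "B \<subseteq> A" "\<mu> A = 0"
  shows "\<mu> B = 0"
  using charge_mono[OF assms(1-4)] charge_nonneg[OF assms(1,3)] assms(5) by simp

text \<open>The supremum is taken in the reals, so boundedness has to be checked: by monotonicity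
  \<open>\<nu> A\<close> bounds the family. The dual rule \<open>null_part_least\<close> needs
  nonemptiness, which \<open>{}\<close> provides.\<close>

lemma null_part_upper:
  assumes "charge M \<nu>" "A \<in> M" "N \<in> M" "N \<subseteq> A" "\<mu> N = 0"
  shows "\<nu> N \<le> null_part M \<mu> \<nu> A"
  unfolding null_part_def
proof (rule cSUP_upper)
  show "bdd_above (\<nu> ` {N \<in> M. N \<subseteq> A \<and> \<mu> N = 0})"
    using charge_mono[OF assms(1,2)] by (intro bdd_aboveI[of _ "\<nu> A"]) auto
qed (use assms in auto)

lemma null_part_least:
  assumes "charge M \<mu>"
    and "\<And>N. N \<in> M \<Longrightarrow> N \<subseteq> A \<Longrightarrow> \<mu> N = 0 \<Longrightarrow> \<nu> N \<le> u"
  shows "null_part M \<mu> \<nu> A \<le> u"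
  unfolding null_part_def
proof (rule cSUP_least)
  show "{N \<in> M. N \<subseteq> A \<and> \<mu> N = 0} \<noteq> {}"
    using charge_empty[OF assms(1)] by blast
qed (use assms in auto)

lemma null_part_le:
  assumes "charge M \<mu>" "charge M \<nu>" "A \<in> M"
  shows "null_part M \<mu> \<nu> A \<le> \<nu> A"
  using assms(1) by (rule null_part_least) (rule charge_mono[OF assms(2,3)])

text \<open>Here \<open>A\<close> itself competes in the supremum. This gives absolute continuity of
  the difference and lets the singularity proof replace the null part of a null set by
  \<open>\<nu>\<close>.\<close>

lemma null_part_null:
  assumes "charge M \<mu>" "charge M \<nu>" "A \<in> M" "\<mu> A = 0"
  shows "null_part M \<mu> \<nu> A = \<nu> A"
  using null_part_le[OF assms(1-3)] null_part_upper[of \<nu> A A \<mu>] assms by force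

text \<open>Additivity holds because a null subset of \<open>A \<union> B\<close> splits into its
  traces on \<open>A\<close> and \<open>B\<close>, and conversely null subsets of disjoint
  \<open>A\<close> and \<open>B\<close> unite to a null set.\<close>

lemma charge_null_part:
  assumes \<mu>: "charge M \<mu>" and \<nu>: "charge M \<nu>"
  shows "charge M (null_part M \<mu> \<nu>)"
  unfolding charge_def additive_def
proof (intro conjI ballI impI)
  fix A assume A: "A \<in> M"
  show "0 \<le> null_part M \<mu> \<nu> A"
    using null_part_upper[OF \<nu> A, of "{}" \<mu>] charge_empty[OF \<mu>] charge_empty[OF \<nu>] by simp
next
  fix A B assume A: "A \<in> M" and B: "B \<in> M" and disj: "A \<inter> B = {}"
  let ?s = "null_part M \<mu> \<nu>"
  show "?s (A \<union> B) = ?s A + ?s B"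
  proof (rule antisym)
    show "?s (A \<union> B) \<le> ?s A + ?s B"
    proof (rule null_part_least[OF \<mu>])
      fix N assume N: "N \<in> M" "N \<subseteq> A \<union> B" "\<mu> N = 0"
      have NA: "N \<inter> A \<in> M" "\<mu> (N \<inter> A) = 0" and NB: "N \<inter> B \<in> M" "\<mu> (N \<inter> B) = 0"
        using N A B by (auto intro!: charge_null_subset[OF \<mu> N(1)])
      have "\<nu> N = \<nu> ((N \<inter> A) \<union> (N \<inter> B))"
        using N(2) by (intro arg_cong[where f = \<nu>]) auto
      also have "\<dots> = \<nu> (N \<inter> A) + \<nu> (N \<inter> B)"
        using disj by (intro charge_Un[OF \<nu> NA(1) NB(1)]) auto
      also have "\<dots> \<le> ?s A + ?s B"
        using NA NB A B by (intro add_mono null_part_upper[OF \<nu>]) auto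
      finally show "\<nu> N \<le> ?s A + ?s B" .
    qed
  next
    \<comment> \<open>The two suprema are bounded one at a time: with \<open>N\<close> fixed, first
      over \<open>K\<close> inside \<open>B\<close>, then over \<open>N\<close> inside
      \<open>A\<close>. Each time the other term is moved to the right so that
      \<open>null_part_least\<close> applies.\<close>
    have "?s A \<le> ?s (A \<union> B) - ?s B"
    proof (rule null_part_least[OF \<mu>])
      fix N assume N: "N \<in> M" "N \<subseteq> A" "\<mu> N = 0"
      have "?s B \<le> ?s (A \<union> B) - \<nu> N"
      proof (rule null_part_least[OF \<mu>])
        fix K assume K: "K \<in> M" "K \<subseteq> B" "\<mu> K = 0"
        have "N \<inter> K = {}" using N(2) K(2) disj by auto
        then have "\<mu> (N \<union> K) = 0" "\<nu> (N \<union> K) = \<nu> N + \<nu> K"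
          using N K charge_Un[OF \<mu>] charge_Un[OF \<nu>] by auto
        moreover have "\<mu> (N \<union> K) = 0 \<Longrightarrow> \<nu> (N \<union> K) \<le> ?s (A \<union> B)"
          using N K A B by (intro null_part_upper[OF \<nu>]) auto
        ultimately show "\<nu> K \<le> ?s (A \<union> B) - \<nu> N" by simp
      qed
      then show "\<nu> N \<le> ?s (A \<union> B) - ?s B" by simp
    qed
    then show "?s A + ?s B \<le> ?s (A \<union> B)" by simp
  qed
qed

lemma charge_le_minus_null_part:
  assumes \<mu>: "charge M \<mu>" and \<theta>: "charge M \<theta>" "charge_le M \<theta> \<nu>" "charge_abs_cont M \<theta> \<mu>"
    and \<nu>: "charge M \<nu>"
  shows "charge_le M \<theta> (\<lambda>A. \<nu> A - null_part M \<mu> \<nu> A)"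
  unfolding charge_le_def
proof
  fix A assume A: "A \<in> M"
  \<comment> \<open>In this rearranged form the claim is an upper bound on a supremum, so a single
    null set \<open>N\<close> can be treated at a time.\<close>
  have "null_part M \<mu> \<nu> A \<le> \<nu> A - \<theta> A"
  proof (rule null_part_least[OF \<mu>])
    fix N assume N: "N \<in> M" "N \<subseteq> A" "\<mu> N = 0"
    have "\<theta> A = \<theta> (A - N)"
      using charge_Diff[OF \<theta>(1) A N(1,2)] N \<theta>(3) by (simp add: charge_abs_cont_def)
    also have "\<dots> \<le> \<nu> (A - N)"
      using \<theta>(2) A N(1) by (auto simp: charge_le_def)
    also have "\<dots> = \<nu> A - \<nu> N"
      by (rule charge_Diff[OF \<nu> A N(1,2)])
    finally show "\<nu> N \<le> \<nu> A - \<theta> A" by simp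
  qed
  then show "\<theta> A \<le> \<nu> A - null_part M \<mu> \<nu> A" by simp
qed

lemma charge_singular_null_part:
  assumes \<mu>: "charge M \<mu>" and \<nu>: "charge M \<nu>"
  shows "charge_singular M (null_part M \<mu> \<nu>) \<mu>"
  unfolding charge_singular_def
proof (intro allI impI ballI, elim conjE)
  fix \<theta> A
  let ?s = "null_part M \<mu> \<nu>"
  assume \<theta>: "charge M \<theta>" and dom_s: "charge_dominated M \<theta> ?s"
    and dom_\<mu>: "charge_dominated M \<theta> \<mu>" and A: "A \<in> M"
  have s: "charge M ?s" by (rule charge_null_part[OF \<mu> \<nu>])
  have ac: "charge_abs_cont M \<theta> \<mu>" by (rule charge_dominated_abs_cont[OF \<theta> dom_\<mu>])
  obtain b where b: "\<And>B. B \<in> M \<Longrightarrow> \<theta> B \<le> b * ?s B"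
    using dom_s by (auto simp: charge_dominated_def charge_le_def)
  \<comment> \<open>The constant \<open>b\<close> may be zero or negative, but a division by it
    follows. Enlarging it is harmless because \<open>?s\<close> is nonnegative.\<close>
  define c where "c = max b 1"
  have "c > 0" by (simp add: c_def)
  have c: "\<theta> B \<le> c * ?s B" if "B \<in> M" for B
  proof -
    have "b * ?s B \<le> c * ?s B"
      using charge_nonneg[OF s that] by (intro mult_right_mono) (simp_all add: c_def)
    with b[OF that] show ?thesis by simp
  qed
  \<comment> \<open>This replaces an epsilon argument: every competitor \<open>\<nu> N\<close> stays
    below the supremum by at least \<open>\<theta> A / c\<close>, which therefore cannot be
    positive.\<close>
  have "?s A \<le> ?s A - \<theta> A / c"
  proof (rule null_part_least[OF \<mu>])
    fix N assume N: "N \<in> M" "N \<subseteq> A" "\<mu> N = 0"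
    have "\<theta> A = \<theta> (A - N)"
      using charge_Diff[OF \<theta> A N(1,2)] N ac by (simp add: charge_abs_cont_def)
    also have "\<dots> \<le> c * ?s (A - N)"
      using A N(1) by (intro c) auto
    also have "?s (A - N) = ?s A - \<nu> N"
      using charge_Diff[OF s A N(1,2)] null_part_null[OF \<mu> \<nu> N(1,3)] by simp
    finally show "\<nu> N \<le> ?s A - \<theta> A / c"
      using \<open>c > 0\<close> by (simp add: field_simps)
  qed
  then have "\<theta> A \<le> 0"
    using \<open>c > 0\<close> by (simp add: divide_le_0_iff)
  with charge_nonneg[OF \<theta> A] show "\<theta> A = 0" by simp
qed

end

theorem theorem3p2:
  fixes T :: "'a set" and \<R> :: "'a set set" and \<mu> \<nu> :: "'a set \<Rightarrow> real"
  assumes "T \<noteq> {}"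
    and "ring_of_sets T \<R>"
    and "charge \<R> \<mu>"
    and "charge \<R> \<nu>"
  shows "\<exists>\<nu>\<^sub>a \<nu>\<^sub>s :: 'a set \<Rightarrow> real.
      charge \<R> \<nu>\<^sub>a \<and> charge \<R> \<nu>\<^sub>s \<and>
      (\<forall>R\<in>\<R>. \<nu> R = \<nu>\<^sub>a R + \<nu>\<^sub>s R) \<and>
      charge_abs_cont \<R> \<nu>\<^sub>a \<mu> \<and> charge_singular \<R> \<nu>\<^sub>s \<mu> \<and>
      (\<forall>\<theta>. charge \<R> \<theta> \<and> charge_le \<R> \<theta> \<nu> \<and> charge_abs_cont \<R> \<theta> \<mu> \<longrightarrow>
         charge_le \<R> \<theta> \<nu>\<^sub>a)"
proof -
  interpret ring_of_sets T \<R> by fact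
  note \<mu> = \<open>charge \<R> \<mu>\<close> and \<nu> = \<open>charge \<R> \<nu>\<close>
  let ?s = "null_part \<R> \<mu> \<nu>"
  let ?a = "\<lambda>R. \<nu> R - ?s R"
  have s: "charge \<R> ?s" by (rule charge_null_part[OF \<mu> \<nu>])
  \<comment> \<open>Additivity passes to differences; nonnegativity is
    \<open>null_part_le\<close>.\<close>
  have "charge \<R> ?a"
    unfolding charge_def additive_def
    using charge_Un[OF \<nu>] charge_Un[OF s] null_part_le[OF \<mu> \<nu>] by simp
  moreover have "charge_abs_cont \<R> ?a \<mu>"
    unfolding charge_abs_cont_def using null_part_null[OF \<mu> \<nu>] by simp
  ultimately show ?thesis
    using s charge_singular_null_part[OF \<mu> \<nu>] charge_le_minus_null_part[OF \<mu> _ _ _ \<nu>]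
    by (intro exI[of _ ?a] exI[of _ ?s]) simp
qed

end
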